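(* Let $S$ be an associative algebra over $\mathbb{K}$ with $S[S,S]=0$. Then the Lie algebra $(S[t],\langle-,-\rangle)$ satisfies $\mathrm{St}_6$.
   Context: $\mathbb{K}$ is a field of characteristic zero. $[x,y]=xy-yx$ in $S$, and $S[S,S]=0$ means $x(yz-zy)=0$ for all $x,y,z\in S$. $S[t]$ is the algebra of polynomials in the (central) indeterminate $t$ with coefficients in $S$, $a'=\frac{d}{dt}a$, and $\langle a,b\rangle:=b'a-a'b$, which is a Lie bracket on $S[t]$ when $S[S,S]=0$. For a Lie algebra with bracket $[-,-]$, $$\mathrm{St}_{n+1}(x_1,\dots,x_n,z):=\sum_{\sigma}(-1)^{\sigma}[x_{\sigma(1)},[x_{\sigma(2)},[\cdots,[x_{\sigma(n)},z]\cdots]]],$$ where $\sigma$ runs over the symmetric group of degree $n$ and $(-1)^\sigma$ is the sign of $\sigma$. The Lie algebra satisfies $\mathrm{St}_{n+1}$ if this expression vanishes for all $x_1,\dots,x_n,z$ in it. *)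

theory Defs
  imports Complex_Main "HOL-Library.Poly_Mapping" "HOL-Combinatorics.Permutations"
begin

text \<open>An associative algebra over a field, not necessarily unital or commutative
  (the type class \<^class>\<open>ring\<close> provides neither a unit nor commutativity). A unit would make the
  condition \<open>S[S,S] = 0\<close> equivalent to commutativity.\<close>

locale assoc_algebra = vector_space scale
  for scale :: "'k::field \<Rightarrow> 's::ring \<Rightarrow> 's" +
  assumes scale_mult_left: "scale c x * y = scale c (x * y)"
    and scale_mult_right: "x * scale c y = scale c (x * y)"

locale lie_algebra = vector_space scale
  for scale :: "'k::field \<Rightarrow> 'l::ab_group_add \<Rightarrow> 'l" +
  fixes bracket :: "'l \<Rightarrow> 'l \<Rightarrow> 'l"
  assumes bracket_add_left: "bracket (x + y) z = bracket x z + bracket y z"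
    and bracket_add_right: "bracket x (y + z) = bracket x y + bracket x z"
    and bracket_scale_left: "bracket (scale c x) y = scale c (bracket x y)"
    and bracket_scale_right: "bracket x (scale c y) = scale c (bracket x y)"
    and bracket_self: "bracket x x = 0"
    and jacobi: "bracket x (bracket y z) + bracket y (bracket z x) + bracket z (bracket x y) = 0"

text \<open>\<open>lie_St scale bracket k x z\<close> is \<open>St\<^sub>k(x\<^sub>1, \<dots>, x\<^sub>n, z)\<close> with \<open>k = n + 1\<close>; only the
  values of \<open>x\<close> at \<open>1, \<dots>, n\<close> matter.\<close>

definition lie_St :: "('k::field \<Rightarrow> 'l::ab_group_add \<Rightarrow> 'l) \<Rightarrow> ('l \<Rightarrow> 'l \<Rightarrow> 'l)
    \<Rightarrow> nat \<Rightarrow> (nat \<Rightarrow> 'l) \<Rightarrow> 'l \<Rightarrow> 'l" where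
  "lie_St scale bracket k x z =
    (\<Sum>\<sigma> | \<sigma> permutes {1..<k}.
       scale (of_int (sign \<sigma>)) (foldr bracket (map (\<lambda>i. x (\<sigma> i)) [1..<k]) z))"

definition satisfies_St :: "('k::field \<Rightarrow> 'l::ab_group_add \<Rightarrow> 'l) \<Rightarrow> ('l \<Rightarrow> 'l \<Rightarrow> 'l)
    \<Rightarrow> nat \<Rightarrow> bool" where
  "satisfies_St scale bracket k \<longleftrightarrow> (\<forall>x z. lie_St scale bracket k x z = 0)"

text \<open>\<open>S[t]\<close> is the type \<^typ>\<open>nat \<Rightarrow>\<^sub>0 's\<close> with its convolution product: the type \<open>'s poly\<close> has no
  product when \<^typ>\<open>'s\<close> is neither commutative nor unital. The following are the \<open>\<bbbK>\<close>-action,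
  the derivation \<open>d/dt\<close> and the bracket \<open>\<langle>a,b\<rangle> = b'a - a'b\<close> on it; the integer factor of
  \<open>d/dt\<close> acts through \<open>\<bbbK>\<close>, as \<open>'s\<close> has no \<^const>\<open>of_nat\<close>.\<close>

definition poly_scale :: "('k::field \<Rightarrow> 's::ring \<Rightarrow> 's) \<Rightarrow> 'k \<Rightarrow> (nat \<Rightarrow>\<^sub>0 's) \<Rightarrow> (nat \<Rightarrow>\<^sub>0 's)" where
  "poly_scale scale c p = Poly_Mapping.map (scale c) p"

definition poly_deriv :: "('k::field \<Rightarrow> 's::ring \<Rightarrow> 's) \<Rightarrow> (nat \<Rightarrow>\<^sub>0 's) \<Rightarrow> (nat \<Rightarrow>\<^sub>0 's)" where
  "poly_deriv scale p =
    (\<Sum>i\<in>Poly_Mapping.keys p.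
       Poly_Mapping.single (i - 1) (scale (of_nat i) (Poly_Mapping.lookup p i)))"

definition poly_bracket :: "('k::field \<Rightarrow> 's::ring \<Rightarrow> 's)
    \<Rightarrow> (nat \<Rightarrow>\<^sub>0 's) \<Rightarrow> (nat \<Rightarrow>\<^sub>0 's) \<Rightarrow> (nat \<Rightarrow>\<^sub>0 's)" where
  "poly_bracket scale a b = poly_deriv scale b * a - poly_deriv scale a * b"

context assoc_algebra
begin

lemma lookup_poly_scale:
  "Poly_Mapping.lookup (poly_scale scale c p) n = scale c (Poly_Mapping.lookup p n)"
  by (simp add: poly_scale_def Poly_Mapping.map.rep_eq when_def)

lemma lookup_poly_deriv:
  "Poly_Mapping.lookup (poly_deriv scale p) n =
    scale (of_nat (Suc n)) (Poly_Mapping.lookup p (Suc n))"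
proof -
  have "Poly_Mapping.lookup (poly_deriv scale p) n =
      (\<Sum>i\<in>Poly_Mapping.keys p.
        if i = Suc n then scale (of_nat i) (Poly_Mapping.lookup p i) else 0)"
    unfolding poly_deriv_def lookup_sum
  proof (intro sum.cong refl)
    fix i
    show "Poly_Mapping.lookup (Poly_Mapping.single (i - 1) (scale (of_nat i) (Poly_Mapping.lookup p i))) n =
        (if i = Suc n then scale (of_nat i) (Poly_Mapping.lookup p i) else 0)"
      by (cases i) (auto simp: lookup_single when_def)
  qed
  also have "\<dots> = scale (of_nat (Suc n)) (Poly_Mapping.lookup p (Suc n))"
    by (auto simp: in_keys_iff)
  finally show ?thesis .
qed

lemma poly_deriv_add: "poly_deriv scale (p + q) = poly_deriv scale p + poly_deriv scale q"
  by (rule poly_mapping_eqI) (simp only: lookup_poly_deriv lookup_add scale_right_distrib)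

lemma poly_deriv_diff: "poly_deriv scale (p - q) = poly_deriv scale p - poly_deriv scale q"
  by (rule poly_mapping_eqI) (simp only: lookup_poly_deriv lookup_minus scale_right_diff_distrib)

lemma poly_deriv_scale:
  "poly_deriv scale (poly_scale scale c p) = poly_scale scale c (poly_deriv scale p)"
  by (rule poly_mapping_eqI)
    (simp only: lookup_poly_deriv lookup_poly_scale scale_scale mult.commute)

lemma poly_deriv_single:
  "poly_deriv scale (Poly_Mapping.single i a) = Poly_Mapping.single (i - 1) (scale (of_nat i) a)"
  by (cases "a = 0") (simp_all add: poly_deriv_def)

lemma poly_scale_single:
  "poly_scale scale c (Poly_Mapping.single i a) = Poly_Mapping.single i (scale c a)"
  by (simp add: poly_scale_def)

lemma poly_scale_add: "poly_scale scale c (p + q) = poly_scale scale c p + poly_scale scale c q"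
  by (rule poly_mapping_eqI) (simp add: lookup_poly_scale lookup_add scale_right_distrib)

lemma poly_induct_single [case_names single add]:
  fixes P :: "(nat \<Rightarrow>\<^sub>0 's) \<Rightarrow> bool"
  assumes "\<And>i a. P (Poly_Mapping.single i a)" "\<And>p q. P p \<Longrightarrow> P q \<Longrightarrow> P (p + q)"
  shows "P p"
proof -
  have "P (\<Sum>i\<in>A. Poly_Mapping.single i (Poly_Mapping.lookup p i))" if "finite A" for A
    using that
  proof (induction A)
    case empty
    show ?case using assms(1)[of 0 0] by simp
  next
    case (insert i A)
    then show ?case by (simp add: assms)
  qed
  moreover have "(\<Sum>i\<in>Poly_Mapping.keys p. Poly_Mapping.single i (Poly_Mapping.lookup p i)) = p"
    by (rule poly_mapping_eqI) (auto simp: lookup_sum lookup_single when_def in_keys_iff)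
  ultimately show ?thesis by (metis finite_keys)
qed

lemma poly_deriv_mult:
  "poly_deriv scale (p * q) = poly_deriv scale p * q + p * poly_deriv scale q"
proof (induction p rule: poly_induct_single)
  case (single i a)
  show ?case
  proof (induction q rule: poly_induct_single)
    case (single j b)
    have "scale 2 x = x + x" for x
      using scale_left_distrib[of 1 1 x] by simp
    then show ?case
      by (cases i; cases j)
        (simp_all add: mult_single poly_deriv_single scale_mult_left scale_mult_right
          single_add [symmetric] scale_left_distrib distrib_left distrib_right add_ac)
  qed (simp add: poly_deriv_add algebra_simps)
qed (simp add: poly_deriv_add algebra_simps)

lemma poly_scale_mult_left:
  "poly_scale scale c p * q = poly_scale scale c (p * q)"
proof (induction p rule: poly_induct_single)
  case (single i a)
  show ?case
  proof (induction q rule: poly_induct_single)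
    case (single j b)
    show ?case by (simp add: mult_single poly_scale_single scale_mult_left)
  qed (simp add: poly_scale_add algebra_simps)
qed (simp add: poly_scale_add algebra_simps)

lemma poly_scale_mult_right:
  "p * poly_scale scale c q = poly_scale scale c (p * q)"
proof (induction p rule: poly_induct_single)
  case (single i a)
  show ?case
  proof (induction q rule: poly_induct_single)
    case (single j b)
    show ?case by (simp add: mult_single poly_scale_single scale_mult_right)
  qed (simp add: poly_scale_add algebra_simps)
qed (simp add: poly_scale_add algebra_simps)

lemma assoc_algebra_poly: "assoc_algebra (poly_scale scale)"
  by unfold_locales
    (auto intro!: poly_mapping_eqI simp: poly_scale_mult_left poly_scale_mult_right
      lookup_poly_scale lookup_add scale_right_distrib scale_left_distrib)

lemma poly_mult_swap:
  fixes p q r :: "nat \<Rightarrow>\<^sub>0 's"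
  assumes "\<forall>x y z :: 's. x * (y * z - z * y) = 0"
  shows "p * q * r = p * r * q"
proof (induction p rule: poly_induct_single)
  case (single i a)
  show ?case
  proof (induction q rule: poly_induct_single)
    case (single j b)
    show ?case
    proof (induction r rule: poly_induct_single)
      case (single k c)
      have "a * b * c = a * c * b"
        using assms by (simp add: algebra_simps)
      then show ?case by (simp add: mult_single add_ac)
    qed (simp add: algebra_simps)
  qed (simp add: algebra_simps)
qed (simp add: algebra_simps)

lemma lie_algebra_poly:
  assumes "\<forall>x y z :: 's. x * (y * z - z * y) = 0"
  shows "lie_algebra (poly_scale scale) (poly_bracket scale)"
proof -
  interpret S: assoc_algebra "poly_scale scale" by (rule assoc_algebra_poly)
  show ?thesis
  proof
    fix x y z :: "nat \<Rightarrow>\<^sub>0 's" and c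
    show "poly_bracket scale (x + y) z = poly_bracket scale x z + poly_bracket scale y z"
      and "poly_bracket scale x (y + z) = poly_bracket scale x y + poly_bracket scale x z"
      and "poly_bracket scale x x = 0"
      by (simp_all add: poly_bracket_def poly_deriv_add algebra_simps)
    show "poly_bracket scale (poly_scale scale c x) y = poly_scale scale c (poly_bracket scale x y)"
      and "poly_bracket scale x (poly_scale scale c y) = poly_scale scale c (poly_bracket scale x y)"
      by (simp_all add: poly_bracket_def poly_deriv_scale S.scale_mult_left S.scale_mult_right
          S.scale_right_diff_distrib)
    let ?d = "poly_deriv scale"
    note swap = poly_mult_swap[OF assms]
    show "poly_bracket scale x (poly_bracket scale y z) + poly_bracket scale y (poly_bracket scale z x)
        + poly_bracket scale z (poly_bracket scale x y) = 0"
      using swap[of "?d (?d x)" y z] swap[of "?d (?d y)" z x] swap[of "?d (?d z)" x y]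
        swap[of "?d x" "?d y" z] swap[of "?d x" "?d z" y]
        swap[of "?d y" "?d x" z] swap[of "?d y" "?d z" x]
        swap[of "?d z" "?d x" y] swap[of "?d z" "?d y" x]
      by (simp add: poly_bracket_def poly_deriv_diff poly_deriv_mult algebra_simps)
  qed
qed

end

end

theory Submission
  imports Defs
begin

text \<open>
  Because \<open>a(bc - cb) = 0\<close> in \<open>S[t]\<close>, the value of a product depends only on its first factor and
  on the multiset of the remaining factors. Expand
  \<open>\<langle>x\<^sub>1,\<langle>x\<^sub>2,\<dots>\<langle>x\<^sub>n,z\<rangle>\<dots>\<rangle>\<rangle>\<close> by the Leibniz rule: the result is a combination of words in which each
  of \<open>x\<^sub>1, \<dots>, x\<^sub>n, z\<close> occurs exactly once, differentiated some number of times, and the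
  orders of differentiation add up to \<open>n\<close>, as every bracket contributes one derivative
  (\<open>nested_bracket_diff_span\<close>). At least \<open>n - 1\<close> of the letters behind the first one are among the
  \<open>x\<^sub>i\<close>. If two of these carry the same order, exchanging them does not
  change the word, so the alternating sum over all permutations of the \<open>x\<^sub>i\<close> annihilates
  it (\<open>alternation_word_eq_0\<close>). Otherwise their orders are pairwise distinct and add up to at least
  \<open>0 + 1 + \<cdots> + (n - 2) = (n - 1)(n - 2)/2\<close>, which exceeds \<open>n\<close> as soon as \<open>n \<ge> 5\<close>
  (\<open>ex_equal_orders\<close>). So no word survives, and \<open>St\<^sub>n\<^sub>+\<^sub>1\<close> holds for every \<open>n \<ge> 5\<close>.

  The argument uses the derivation only through additivity and the Leibniz rule and is
  carried out in that generality. The element \<open>z\<close> is treated as a letter with index \<open>0\<close>, which the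
  permutations of \<open>{1..n}\<close> fix.
\<close>

section \<open>Distinct orders of differentiation\<close>

lemma card_mult_le_sum:
  fixes A :: "nat set"
  assumes "finite A"
  shows "card A * (card A - 1) \<le> 2 * \<Sum>A"
  using assms
proof (induction "card A" arbitrary: A)
  case 0
  then show ?case by simp
next
  case (Suc n)
  define M where "M = Max A"
  have "A \<noteq> {}" using Suc.hyps(2) by auto
  then have M: "M \<in> A" using Suc.prems by (simp add: M_def)
  have n: "card (A - {M}) = n" using M Suc by simp
  have "A - {M} \<subseteq> {..<M}"
    using Suc.prems unfolding M_def by (auto simp: order_less_le)
  then have "n \<le> M" using n card_mono[of "{..<M}" "A - {M}"] by simp
  have IH: "n * (n - 1) \<le> 2 * \<Sum>(A - {M})"
    using Suc.hyps(1)[of "A - {M}"] Suc.prems n by simp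
  have "\<Sum>A = M + \<Sum>(A - {M})" using Suc.prems M by (simp add: sum.remove)
  moreover have "Suc n * n = n * (n - 1) + 2 * n" by (cases n) simp_all
  ultimately have "Suc n * n \<le> 2 * \<Sum>A" using IH \<open>n \<le> M\<close> by linarith
  then show ?case using Suc.hyps(2)[symmetric] by simp
qed

text \<open>A pair \<open>(i, m)\<close> stands for the \<open>m\<close>-th derivative of the letter \<open>i\<close>, and \<open>a\<close> is the first
  factor of a word with remaining factors \<open>u\<close>. Behind \<open>a\<close> there are at least \<open>k - 2\<close> nonzero
  letters; orders that tell them apart would have sum at least \<open>(k - 2)(k - 3)/2 > k - 1\<close>.\<close>

lemma ex_equal_orders:
  fixes a :: "nat \<times> nat"
  assumes letters: "mset (map fst (a # u)) = mset [0..<k]"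
    and weight: "sum_list (map snd (a # u)) = k - 1"
    and k: "k \<ge> 6"
  obtains i j m where "(i, m) \<in> set u" "(j, m) \<in> set u" "i \<noteq> j" "i \<noteq> 0" "j \<noteq> 0"
proof -
  define B where "B = {b \<in> set u. fst b \<noteq> 0}"
  have "\<exists>b\<in>B. \<exists>c\<in>B. b \<noteq> c \<and> snd b = snd c"
  proof (rule ccontr)
    assume "\<not> ?thesis"
    then have inj: "inj_on snd B" by (auto simp: inj_on_def)
    have fin: "finite B" by (simp add: B_def)
    have dist: "distinct u"
      using mset_eq_imp_distinct_iff[OF letters] by (simp add: distinct_map)
    have "{1..<k} - {fst a} \<subseteq> fst ` B"
      using mset_eq_setD[OF letters] by (force simp: B_def)
    then have "card ({1..<k} - {fst a}) \<le> card (fst ` B)"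
      using fin by (intro card_mono) auto
    also have "\<dots> \<le> card B" using fin by (rule card_image_le)
    finally have "k - 2 \<le> card B"
      by (cases "fst a \<in> {1..<k}") (auto simp: card_Diff_singleton_if)
    then have "(k - 2) * (k - 3) \<le> card B * (card B - 1)"
      by (intro mult_mono) auto
    also have "\<dots> \<le> 2 * \<Sum>(snd ` B)"
      using card_mult_le_sum[of "snd ` B"] fin card_image[OF inj] by simp
    also have "\<Sum>(snd ` B) = sum snd B" using inj by (simp add: sum.reindex)
    also have "\<dots> \<le> sum snd (set u)" by (rule sum_mono2) (auto simp: B_def)
    also have "\<dots> = sum_list (map snd u)"
      using dist by (simp add: sum_list_distinct_conv_sum_set)
    also have "\<dots> \<le> k - 1" using weight by simp
    finally have "(k - 2) * (k - 3) \<le> 2 * (k - 1)" by simp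
    moreover obtain l where "k = l + 6" using k by (metis add.commute le_Suc_ex)
    ultimately show False by (simp add: algebra_simps)
  qed
  then show thesis
    using that unfolding B_def by (smt (verit) mem_Collect_eq prod.collapse prod_eqI)
qed


section \<open>Words in an algebra with derivation\<close>

locale right_commutative_differential_algebra = assoc_algebra scale
  for scale :: "'k::field_char_0 \<Rightarrow> 's::ring \<Rightarrow> 's" +
  fixes D :: "'s \<Rightarrow> 's"
  assumes D_add: "D (a + b) = D a + D b"
    and D_mult: "D (a * b) = D a * b + a * D b"
    and mult_swap: "a * b * c = a * c * b"
begin

lemma D_diff: "D (a - b) = D a - D b"
  using D_add[of "a - b" b] by simp

definition bracket :: "'s \<Rightarrow> 's \<Rightarrow> 's" where
  "bracket a b = D b * a - D a * b"

definition factor :: "(nat \<Rightarrow> 's) \<Rightarrow> nat \<times> nat \<Rightarrow> 's" where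
  "factor y b = (D ^^ snd b) (y (fst b))"

text \<open>There is no empty word, as \<open>S\<close> need not have a unit; hence the first factor is a separate
  argument.\<close>

definition word :: "nat \<times> nat \<Rightarrow> (nat \<times> nat) list \<Rightarrow> (nat \<Rightarrow> 's) \<Rightarrow> 's" where
  "word a u y = fold (\<lambda>b p. p * factor y b) u (factor y a)"

lemma word_Nil: "word a [] y = factor y a"
  by (simp add: word_def)

lemma word_snoc: "word a (u @ [b]) y = word a u y * factor y b"
  by (simp add: word_def)

lemma factor_mult_word: "factor y b * word a u y = word b (a # u) y"
proof (induction u rule: rev_induct)
  case Nil
  then show ?case by (simp add: word_def)
next
  case (snoc c u)
  have "factor y b * word a (u @ [c]) y = factor y b * word a u y * factor y c"
    by (simp add: word_snoc mult.assoc)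
  then show ?case using snoc word_snoc[of b "a # u"] by simp
qed

lemma word_mset_cong:
  assumes "mset u = mset v"
  shows "word a u y = word a v y"
proof -
  have "fold (\<lambda>b p. p * factor y b) u = fold (\<lambda>b p. p * factor y b) v"
    using assms by (intro fold_multiset_equiv) (auto simp: fun_eq_iff intro: mult_swap)
  then show ?thesis by (simp add: word_def)
qed

lemma word_comp: "word a u (y \<circ> f) = word (apfst f a) (map (apfst f) u) y"
  by (simp add: word_def factor_def fold_map comp_def)

text \<open>Renaming the letters by the transposition exchanges two factors behind the first one, where
  factors commute; as letters do not repeat, no other factor is renamed.\<close>

lemma word_transpose:
  assumes dist: "distinct (map fst (a # u))"
    and i: "(i, m) \<in> set u" and j: "(j, m) \<in> set u"
  shows "word a u (y \<circ> transpose i j) = word a u y"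
proof (cases "i = j")
  case True
  then show ?thesis by simp
next
  case False
  obtain A where A: "mset u = add_mset (i, m) A"
    using i multi_member_split[of "(i, m)" "mset u"] by auto
  have "(j, m) \<in># mset u" using j by simp
  then have "(j, m) \<in># A" using False unfolding A by simp
  then obtain R where "A = add_mset (j, m) R"
    by (rule multi_member_split[THEN exE])
  with A have u: "mset u = add_mset (i, m) (add_mset (j, m) R)" by simp
  have "distinct (map fst u)" using dist by simp
  then have cnt: "count (image_mset fst (mset u)) l \<le> 1" for l
    using distinct_count_atmost_1[of "map fst u"] by simp
  have "count (image_mset fst R) i = 0" "count (image_mset fst R) j = 0"
    using cnt[of i] cnt[of j] False unfolding u by simp_all
  then have "i \<notin># image_mset fst R" "j \<notin># image_mset fst R"
    by (simp_all only: not_in_iff)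
  then have R: "fst b \<noteq> i \<and> fst b \<noteq> j" if "b \<in># R" for b
    using that by (metis image_eqI set_image_mset)
  have "image_mset (apfst (transpose i j)) R = image_mset id R"
    using R by (intro image_mset_cong) (auto simp: apfst_def map_prod_def split: prod.splits)
  then have "mset (map (apfst (transpose i j)) u) = mset u"
    by (simp add: u)
  moreover have "fst a \<noteq> i" "fst a \<noteq> j"
    using dist image_eqI[OF _ i, of _ fst] image_eqI[OF _ j, of _ fst] by auto
  then have "apfst (transpose i j) a = a"
    by (cases a) (simp add: transpose_def)
  ultimately show ?thesis
    using word_mset_cong unfolding word_comp by metis
qed

text \<open>Integer combinations of the words of one bidegree: the letters are those of \<open>L\<close>, and \<open>d\<close> is the
  total order of differentiation. They are taken as functions of the values of the letters, so that
  one expansion of the nested bracket serves all permutations \<open>\<sigma>\<close> at once, by substituting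
  \<open>y = x \<circ> \<sigma>\<close>.\<close>

inductive diff_span :: "nat multiset \<Rightarrow> nat \<Rightarrow> ((nat \<Rightarrow> 's) \<Rightarrow> 's) \<Rightarrow> bool"
  for L :: "nat multiset" and d :: nat where
  word: "mset (map fst (a # u)) = L \<Longrightarrow> sum_list (map snd (a # u)) = d
    \<Longrightarrow> diff_span L d (word a u)"
| add: "diff_span L d f \<Longrightarrow> diff_span L d g \<Longrightarrow> diff_span L d (\<lambda>y. f y + g y)"
| diff: "diff_span L d f \<Longrightarrow> diff_span L d g \<Longrightarrow> diff_span L d (\<lambda>y. f y - g y)"

lemma diff_span_mult_factor:
  assumes "diff_span L d f"
  shows "diff_span (add_mset i L) (d + m) (\<lambda>y. f y * factor y (i, m))"
  using assms
proof induction
  case (word a u)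
  then have "diff_span (add_mset i L) (d + m) (word a (u @ [(i, m)]))"
    by (intro diff_span.word) auto
  then show ?case by (simp add: word_snoc[abs_def])
qed (simp_all add: algebra_simps diff_span.add diff_span.diff)

lemma diff_span_factor_mult:
  assumes "diff_span L d f"
  shows "diff_span (add_mset i L) (d + m) (\<lambda>y. factor y (i, m) * f y)"
  using assms
proof induction
  case (word a u)
  then have "diff_span (add_mset i L) (d + m) (word (i, m) (a # u))"
    by (intro diff_span.word) auto
  then show ?case by (simp add: factor_mult_word)
qed (simp_all add: algebra_simps diff_span.add diff_span.diff)

lemma diff_span_D_word:
  "diff_span (mset (map fst (a # u))) (Suc (sum_list (map snd (a # u)))) (\<lambda>y. D (word a u y))"
proof (induction u rule: rev_induct)
  case Nil
  have "diff_span {#fst a#} (Suc (snd a)) (word (fst a, Suc (snd a)) [])"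
    by (rule diff_span.word) auto
  moreover have "word (fst a, Suc (snd a)) [] = (\<lambda>y. D (word a [] y))"
    by (simp add: word_Nil factor_def fun_eq_iff)
  ultimately show ?case by simp
next
  case (snoc b u)
  let ?L = "mset (map fst (a # u @ [b]))" and ?d = "Suc (sum_list (map snd (a # u @ [b])))"
  have "diff_span ?L ?d (\<lambda>y. D (word a u y) * factor y (fst b, snd b))"
    using diff_span_mult_factor[OF snoc, of "fst b" "snd b"] by (simp add: add_mset_commute add_ac)
  moreover have "diff_span ?L ?d (word a (u @ [(fst b, Suc (snd b))]))"
    by (rule diff_span.word) auto
  ultimately have "diff_span ?L ?d
      (\<lambda>y. D (word a u y) * factor y (fst b, snd b) + word a (u @ [(fst b, Suc (snd b))]) y)"
    by (rule diff_span.add)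
  then show ?case by (simp add: word_snoc D_mult factor_def)
qed

lemma diff_span_D:
  assumes "diff_span L d f"
  shows "diff_span L (Suc d) (\<lambda>y. D (f y))"
  using assms
proof induction
  case (word a u)
  then show ?case using diff_span_D_word[of a u] by simp
qed (simp_all add: D_add D_diff diff_span.add diff_span.diff)

text \<open>Each bracket \<open>D(f) x\<^sub>j - D(x\<^sub>j) f\<close> brings in the letter \<open>j\<close> once and one derivative, which acts
  either on the old word or on the new letter.\<close>

lemma nested_bracket_diff_span:
  "diff_span (mset (i # l)) (length l) (\<lambda>y. foldr bracket (map y l) (y i))"
proof (induction l)
  case Nil
  have "diff_span {#i#} 0 (word (i, 0) [])"
    by (rule diff_span.word) auto
  then show ?case by (simp add: word_Nil[abs_def] factor_def)
next
  case (Cons j l)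
  let ?f = "\<lambda>y. foldr bracket (map y l) (y i)"
  from diff_span_mult_factor[OF diff_span_D[OF Cons], of j 0]
  have "diff_span (mset (i # j # l)) (Suc (length l)) (\<lambda>y. D (?f y) * y j)"
    by (simp add: factor_def add_mset_commute)
  moreover from diff_span_factor_mult[OF Cons, of j 1]
  have "diff_span (mset (i # j # l)) (Suc (length l)) (\<lambda>y. D (y j) * ?f y)"
    by (simp add: factor_def add_mset_commute)
  ultimately have "diff_span (mset (i # j # l)) (Suc (length l))
      (\<lambda>y. D (?f y) * y j - D (y j) * ?f y)"
    by (rule diff_span.diff)
  then show ?case by (simp add: bracket_def[of "y j" for y] add_mset_commute)
qed


section \<open>Alternating sums\<close>

definition alternation :: "nat \<Rightarrow> (nat \<Rightarrow> 's) \<Rightarrow> ((nat \<Rightarrow> 's) \<Rightarrow> 's) \<Rightarrow> 's" where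
  "alternation k x f =
    (\<Sum>\<sigma> | \<sigma> permutes {1..<k}. scale (of_int (sign \<sigma>)) (f (x \<circ> \<sigma>)))"

text \<open>Composing \<open>\<sigma>\<close> with the transposition keeps the value of \<open>f\<close> and flips the sign, so the sum is
  its own negative; in characteristic zero it vanishes.\<close>

lemma alternation_eq_0_if_symmetric:
  assumes i: "i \<in> {1..<k}" and j: "j \<in> {1..<k}" and "i \<noteq> j"
    and f: "\<And>y. f (y \<circ> transpose i j) = f y"
  shows "alternation k x f = 0"
proof -
  let ?P = "{\<sigma>. \<sigma> permutes {1..<k}}"
  let ?g = "\<lambda>\<sigma>. scale (of_int (sign \<sigma>)) (f (x \<circ> \<sigma>))"
  have "alternation k x f = (\<Sum>\<sigma>\<in>?P. ?g (\<sigma> \<circ> transpose i j))"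
    unfolding alternation_def
    by (rule sum_permutations_compose_right) (rule permutes_swap_id[OF i j])
  also have "\<dots> = (\<Sum>\<sigma>\<in>?P. - ?g \<sigma>)"
  proof (rule sum.cong[OF refl])
    fix \<sigma> assume "\<sigma> \<in> ?P"
    then have "permutation \<sigma>" using permutation_permutes by blast
    then have "sign (\<sigma> \<circ> transpose i j) = - sign \<sigma>"
      using \<open>i \<noteq> j\<close> by (simp add: sign_compose permutation_swap_id sign_swap_id)
    then show "?g (\<sigma> \<circ> transpose i j) = - ?g \<sigma>"
      using f[of "x \<circ> \<sigma>"] by (simp add: o_assoc)
  qed
  also have "\<dots> = - alternation k x f"
    by (simp add: alternation_def sum_negf)
  finally have "alternation k x f + alternation k x f = 0"
    by (metis add.right_inverse)
  then have "scale 2 (alternation k x f) = 0"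
    using scale_left_distrib[of 1 1 "alternation k x f"] by simp
  then show ?thesis by simp
qed

lemma alternation_word_eq_0:
  assumes letters: "mset (map fst (a # u)) = mset [0..<k]"
    and weight: "sum_list (map snd (a # u)) = k - 1"
    and "k \<ge> 6"
  shows "alternation k x (word a u) = 0"
proof -
  obtain i j m where ij: "(i, m) \<in> set u" "(j, m) \<in> set u" "i \<noteq> j" "i \<noteq> 0" "j \<noteq> 0"
    using ex_equal_orders[OF assms] .
  have "{i, j} \<subseteq> set (map fst (a # u))" using ij by force
  then have "{i, j} \<subseteq> {0..<k}" unfolding mset_eq_setD[OF letters] by simp
  then have "i \<in> {1..<k}" "j \<in> {1..<k}" using ij by auto
  moreover have "distinct (map fst (a # u))"
    using mset_eq_imp_distinct_iff[OF letters] by simp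
  ultimately show ?thesis
    using ij by (intro alternation_eq_0_if_symmetric[of i k j] word_transpose[of a u i m j]) auto
qed

lemma alternation_diff_span_eq_0:
  assumes "diff_span (mset [0..<k]) (k - 1) f" "k \<ge> 6"
  shows "alternation k x f = 0"
  using assms(1)
proof induction
  case (word a u)
  then show ?case using assms(2) by (rule alternation_word_eq_0)
next
  case (add f g)
  have "alternation k x (\<lambda>y. f y + g y) = alternation k x f + alternation k x g"
    by (simp add: alternation_def scale_right_distrib sum.distrib)
  then show ?case using add by simp
next
  case (diff f g)
  have "alternation k x (\<lambda>y. f y - g y) = alternation k x f - alternation k x g"
    by (simp add: alternation_def scale_right_diff_distrib sum_subtractf)
  then show ?case using diff by simp
qed

theorem satisfies_St_bracket:
  assumes "k \<ge> 6"
  shows "satisfies_St scale bracket k"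
  unfolding satisfies_St_def
proof (intro allI)
  fix x z
  let ?F = "\<lambda>y. foldr bracket (map y [1..<k]) (y 0)"
  have "lie_St scale bracket k x z = alternation k (x(0 := z)) ?F"
    unfolding lie_St_def alternation_def
  proof (rule sum.cong[OF refl])
    fix \<sigma> assume "\<sigma> \<in> {\<sigma>. \<sigma> permutes {1..<k}}"
    then have \<sigma>: "\<sigma> permutes {1..<k}" by simp
    have "\<sigma> 0 = 0" using permutes_not_in[OF \<sigma>] by simp
    moreover have "\<sigma> i \<noteq> 0" if "i \<in> {1..<k}" for i
      using permutes_in_image[OF \<sigma>, of i] that by auto
    then have "map (x(0 := z) \<circ> \<sigma>) [1..<k] = map (\<lambda>i. x (\<sigma> i)) [1..<k]"
      unfolding map_eq_conv set_upt by (metis comp_apply fun_upd_other)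
    ultimately show "scale (of_int (sign \<sigma>)) (foldr bracket (map (\<lambda>i. x (\<sigma> i)) [1..<k]) z)
        = scale (of_int (sign \<sigma>)) (?F (x(0 := z) \<circ> \<sigma>))"
      by (simp only: comp_apply fun_upd_same)
  qed
  also have "[0..<k] = 0 # [1..<k]" using assms by (simp add: upt_conv_Cons)
  then have "diff_span (mset [0..<k]) (k - 1) ?F"
    using nested_bracket_diff_span[of 0 "[1..<k]"] by simp
  then have "alternation k (x(0 := z)) ?F = 0"
    using assms by (rule alternation_diff_span_eq_0)
  finally show "lie_St scale bracket k x z = 0" .
qed

end


section \<open>Polynomials\<close>

theorem proposition6p3:
  fixes scale :: "'k::field_char_0 \<Rightarrow> 's::ring \<Rightarrow> 's"
  assumes "assoc_algebra scale"
    and "\<forall>x y z :: 's. x * (y * z - z * y) = 0"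
  shows "satisfies_St (poly_scale scale) (poly_bracket scale) 6"
proof -
  interpret S: assoc_algebra scale by (rule assms(1))
  interpret P: assoc_algebra "poly_scale scale" by (rule S.assoc_algebra_poly)
  interpret P: right_commutative_differential_algebra "poly_scale scale" "poly_deriv scale"
    by unfold_locales (rule S.poly_deriv_add S.poly_deriv_mult S.poly_mult_swap[OF assms(2)])+
  have "P.bracket = poly_bracket scale"
    by (simp add: fun_eq_iff P.bracket_def poly_bracket_def)
  then show ?thesis using P.satisfies_St_bracket[of 6] by simp
qed

end
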